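(* Let the representation space be the space of polynomials in $D$ variables of degree at most $3$. For a triangle ($D=2$) the optimal interior weight is $\overline M^\star=\frac{20}{9}$, and the optimal retentional points are located at the cell center and at the centers (midpoints) of the edges; that is, there is a quadrature rule $\overline{\mathcal C}(U)=\sum_{\mathbf x\in X}w_{\mathbf x}U(\mathbf x)+\frac{9}{20}\overline{\mathcal B}(U)$, exact for all polynomials of degree at most $3$, with nonnegative weights $w_{\mathbf x}$ and $X$ consisting of the centroid and the edge midpoints. For a tetrahedron ($D=3$) the optimal interior weight is $\overline M^\star=\frac{11}{6}$.
   Context: For a simplex $K\subset\mathbb R^D$, $\overline{\mathcal C}(U)$ is the average of $U$ over $K$, and $\overline{\mathcal B}(U)$ is the arithmetic mean over the $D+1$ faces (of dimension $D-1$) of the average of $U$ on each face (for the canonical regular simplex this is the average over $\partial K$). $\overline M^\star:=\sup\{\overline{\mathcal B}(U)/\overline{\mathcal C}(U)\}$ over polynomials $U$ of degree at most $3$ in $D$ variables with $U\ge0$ in $K$ and $\overline{\mathcal C}(U)>0$. Optimal retentional points are the points of a quadrature rule $\overline{\mathcal C}(U)=\sum_{\mathbf x\in X}w_{\mathbf x}U(\mathbf x)+\overline W\,\overline{\mathcal B}(U)$, exact on the representation space, with $w_{\mathbf x}\ge0$ and $\overline W=1/\overline M^\star$. *)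

theory Defs
  imports "HOL-Analysis.Analysis"
begin

text \<open>A simplex in \<open>\<real>\<^sup>D\<close> is given by its set \<open>V\<close> of \<open>D + 1\<close> affinely independent vertices;
  the cell is \<open>convex hull V\<close> and its faces are the sets \<open>convex hull (V - {v})\<close>, \<open>v \<in> V\<close>.\<close>

definition simplex_vertices :: "(real ^ 'n) set \<Rightarrow> bool" where
  "simplex_vertices V \<longleftrightarrow> card V = CARD('n) + 1 \<and> \<not> affine_dependent V"

definition polys_upto :: "nat \<Rightarrow> (real ^ 'n \<Rightarrow> real) set" where
  "polys_upto d = {U. \<exists>c :: ('n \<Rightarrow> nat) \<Rightarrow> real.
     U = (\<lambda>x. \<Sum>e | (\<Sum>i\<in>UNIV. e i) \<le> d. c e * (\<Prod>i\<in>UNIV. x $ i ^ e i))}"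

definition cell_avg :: "(real ^ 'n) set \<Rightarrow> (real ^ 'n \<Rightarrow> real) \<Rightarrow> real" where
  "cell_avg V U = integral (convex hull V) U / measure lebesgue (convex hull V)"

text \<open>Average over the (possibly lower-dimensional) simplex with vertex set \<open>V\<close> with respect to
  its surface measure. The simplex is parametrized by the barycentric coordinates of the vertices
  other than a base vertex \<open>a\<close>. This parametrization is affine, so its surface element
  is constant and cancels in the average; for the same reason the value does not depend on
  the choice of \<open>a\<close>.\<close>

definition bary_space :: "'a set \<Rightarrow> ('a \<Rightarrow> real) measure" where
  "bary_space I = (\<Pi>\<^sub>M v\<in>I. lborel)"

definition bary_simplex :: "'a set \<Rightarrow> ('a \<Rightarrow> real) set" where
  "bary_simplex I = {t \<in> space (bary_space I). (\<forall>v\<in>I. 0 \<le> t v) \<and> (\<Sum>v\<in>I. t v) \<le> 1}"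

definition simplex_avg :: "(real ^ 'n) set \<Rightarrow> (real ^ 'n \<Rightarrow> real) \<Rightarrow> real" where
  "simplex_avg V U =
     (let a = (SOME a. a \<in> V); I = V - {a} in
        (LINT t : bary_simplex I | bary_space I. U (a + (\<Sum>v\<in>I. t v *\<^sub>R (v - a))))
        / measure (bary_space I) (bary_simplex I))"

definition boundary_avg :: "(real ^ 'n) set \<Rightarrow> (real ^ 'n \<Rightarrow> real) \<Rightarrow> real" where
  "boundary_avg V U = (\<Sum>v\<in>V. simplex_avg (V - {v}) U) / real (card V)"

text \<open>The supremum is taken in the extended reals, where it always exists. The parameter \<open>P\<close> is the
  representation space.\<close>

definition optimal_interior_weight ::
    "(real ^ 'n \<Rightarrow> real) set \<Rightarrow> (real ^ 'n) set \<Rightarrow> ereal" where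
  "optimal_interior_weight P V =
     Sup {ereal (boundary_avg V U / cell_avg V U) | U.
            U \<in> P \<and> (\<forall>x \<in> convex hull V. 0 \<le> U x) \<and> 0 < cell_avg V U}"

definition quadrature_rule :: "(real ^ 'n \<Rightarrow> real) set \<Rightarrow> (real ^ 'n) set \<Rightarrow>
    (real ^ 'n) set \<Rightarrow> (real ^ 'n \<Rightarrow> real) \<Rightarrow> real \<Rightarrow> bool" where
  "quadrature_rule P V X w W \<longleftrightarrow> finite X \<and> (\<forall>x\<in>X. 0 \<le> w x) \<and>
     (\<forall>U\<in>P. cell_avg V U = (\<Sum>x\<in>X. w x * U x) + W * boundary_avg V U)"

definition optimal_retentional_points ::
    "(real ^ 'n \<Rightarrow> real) set \<Rightarrow> (real ^ 'n) set \<Rightarrow> (real ^ 'n) set \<Rightarrow> bool" where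
  "optimal_retentional_points P V X \<longleftrightarrow>
     (\<exists>w W. ereal W = 1 / optimal_interior_weight P V \<and> quadrature_rule P V X w W)"

definition centroid :: "(real ^ 'n) set \<Rightarrow> real ^ 'n" where
  "centroid V = (1 / real (card V)) *\<^sub>R (\<Sum>v\<in>V. v)"

definition edge_midpoints :: "(real ^ 'n) set \<Rightarrow> (real ^ 'n) set" where
  "edge_midpoints V = {midpoint a b | a b. a \<in> V \<and> b \<in> V \<and> a \<noteq> b}"

end

theory Submission
  imports Defs
begin

text \<open>
  Let \<open>k = D + 1\<close> be the number of vertices of the cell. Every polynomial of degree at most \<open>3\<close> is a linear
  combination of products \<open>f g h\<close> of three affine functions, and an affine function is determined by its
  values at the vertices. Dirichlet's integral gives the average of \<open>f g h\<close> over any simplex as a fixed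
  combination of three numbers, symmetric in the vertices:
  \<open>A = \<Sum>f \<cdot> \<Sum>g \<cdot> \<Sum>h\<close>, \<open>B = \<Sum>f \<cdot> \<Sum>g h + \<Sum>g \<cdot> \<Sum>f h + \<Sum>h \<cdot> \<Sum>f g\<close> and \<open>C = \<Sum>f g h\<close>
  (\<open>simplex_avg_affine3\<close>). The average over the boundary (\<open>boundary_avg_affine3\<close>), the value at the centroid and the
  sum of the values at the centroids of the faces are combinations of \<open>A\<close>, \<open>B\<close> and \<open>C\<close> as well. Hence a quadrature
  rule whose points are the centroid of the cell and the centroids of its faces, the latter with equal weights, amounts
  to three linear equations for the three weights, and these have exactly one solution (\<open>quadrature_identity\<close>). The weight of
  the boundary average in it is \<open>3 k (k - 1) / ((3 k - 1) (k + 2))\<close>; the point weights are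
  nonnegative for \<open>3 \<le> k \<le> 7\<close>.

  Nonnegative point weights make the reciprocal of the boundary weight an upper bound for the supremum. The bound is
  attained at every nonnegative cubic that vanishes at all quadrature points and is not null
  (\<open>optimal_interior_weight_eqI\<close>). Such a cubic is Schur's polynomial
  \<open>x (x - y) (x - z) + y (y - z) (y - x) + z (z - x) (z - y)\<close> in any three barycentric coordinates: it is nonnegative
  for nonnegative arguments and vanishes both when all arguments are equal and when one is zero and the
  other two are equal. The centroid of the cell has equal barycentric coordinates; at the centroid of a face
  one of them is zero and the others are equal.

  This determines the optimal weight in every dimension from \<open>2\<close> to \<open>6\<close> (\<open>cubic_optimal_weight\<close>); the triangle and
  the tetrahedron are \<open>k = 3\<close> and \<open>k = 4\<close>. In a triangle the centroids of the faces are the midpoints of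
  the edges.
\<close>

section \<open>Dirichlet integrals in barycentric coordinates\<close>

text \<open>The exponent \<open>a\<close> moves to the other factor by integration by parts; the boundary terms vanish.\<close>

lemma Beta_nat_has_integral:
  fixes t :: real
  assumes "0 \<le> t"
  shows "((\<lambda>y. y ^ a * (t - y) ^ b) has_integral
           fact a * fact b / fact (a + b + 1) * t ^ (a + b + 1)) {0..t}"
proof (induction a arbitrary: b)
  case 0
  have "((\<lambda>y. - ((t - y) ^ Suc b / Suc b)) has_real_derivative (t - y) ^ b) (at y within {0..t})" for y
    by (rule derivative_eq_intros refl | simp del: power_Suc of_nat_Suc)+
  then have "((\<lambda>y. (t - y) ^ b) has_integral (- ((t - t) ^ Suc b / Suc b) - - ((t - 0) ^ Suc b / Suc b))) {0..t}"
    by (intro fundamental_theorem_of_calculus assms)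
       (simp add: has_real_derivative_iff_has_vector_derivative)
  then show ?case by simp
next
  case (Suc a)
  let ?F = "\<lambda>y. - (y ^ Suc a * (t - y) ^ Suc b)"
  have "(?F has_real_derivative
      real (Suc b) * (y ^ Suc a * (t - y) ^ b) - real (Suc a) * (y ^ a * (t - y) ^ Suc b)) (at y within {0..t})" for y
    by (rule derivative_eq_intros refl | simp del: power_Suc of_nat_Suc add: algebra_simps)+
  then have "((\<lambda>y. real (Suc b) * (y ^ Suc a * (t - y) ^ b) - real (Suc a) * (y ^ a * (t - y) ^ Suc b))
          has_integral (?F t - ?F 0)) {0..t}"
    by (intro fundamental_theorem_of_calculus assms)
       (simp add: has_real_derivative_iff_has_vector_derivative)
  from has_integral_add[OF this has_integral_mult_right[OF Suc.IH[of "Suc b"], of "real (Suc a)"]]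
  have "((\<lambda>y. real (Suc b) * (y ^ Suc a * (t - y) ^ b)) has_integral
      real (Suc a) * (fact a * fact (Suc b) / fact (a + Suc b + 1) * t ^ (a + Suc b + 1))) {0..t}"
    by simp
  from has_integral_mult_right[OF this, of "1 / real (Suc b)"]
  have "((\<lambda>y. y ^ Suc a * (t - y) ^ b) has_integral
      1 / real (Suc b) * (real (Suc a) * (fact a * fact (Suc b) / fact (a + Suc b + 1) * t ^ (a + Suc b + 1)))) {0..t}"
    by (simp del: of_nat_Suc power_Suc fact_Suc)
  moreover have "1 / real (Suc b) * (real (Suc a) * (fact a * fact (Suc b) / fact (a + Suc b + 1) * t ^ (a + Suc b + 1)))
     = fact (Suc a) * fact b / fact (Suc a + b + 1) * t ^ (Suc a + b + 1)"
    by (simp add: fact_Suc[of a] fact_Suc[of b] del: of_nat_Suc power_Suc fact_Suc)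
  ultimately show ?case by (simp only:)
qed

lemma nn_integral_Beta_nat:
  fixes t :: real
  assumes "0 \<le> t"
  shows "(\<integral>\<^sup>+ y. ennreal (indicator {0..t} y * (y ^ a * (t - y) ^ b)) \<partial>lborel) =
           ennreal (fact a * fact b / fact (a + b + 1) * t ^ (a + b + 1))"
  using nn_integral_has_integral_lebesgue[OF _ Beta_nat_has_integral[OF assms]] assms
  by (simp add: nn_integral_completion)

text \<open>Fixing the coordinate \<open>y\<close> of one index leaves a simplex of size \<open>s - y\<close> in the others, whose integral is a
multiple of a power of \<open>s - y\<close>. The remaining integral over \<open>y\<close> is a Beta integral. The size \<open>s\<close> and the factor
\<open>(s - sum t I) ^ k\<close> are general so that the induction over \<open>I\<close> goes through.\<close>

lemma dirichlet_nn_integral: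
  assumes "finite I" "0 \<le> s"
  shows "(\<integral>\<^sup>+ t. ennreal (indicator {t. (\<forall>v\<in>I. 0 \<le> t v) \<and> sum t I \<le> s} t *
            ((\<Prod>v\<in>I. t v ^ e v) * (s - sum t I) ^ k)) \<partial>(\<Pi>\<^sub>M v\<in>I. lborel)) =
         ennreal ((\<Prod>v\<in>I. fact (e v)) * fact k / fact (k + sum e I + card I) *
            s ^ (k + sum e I + card I))"
  using assms
proof (induction arbitrary: s rule: finite_induct)
  case empty
  then show ?case by (simp add: PiM_empty nn_integral_count_space_finite)
next
  case (insert b I)
  interpret product_sigma_finite "\<lambda>_. lborel :: real measure" by standard
  define S where "S = (\<lambda>I s. {t :: 'a \<Rightarrow> real. (\<forall>v\<in>I. 0 \<le> t v) \<and> sum t I \<le> s})"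
  define F where "F = (\<lambda>I s t. indicator (S I s) t * ((\<Prod>v\<in>I. t v ^ e v) * (s - sum t I) ^ k))"
  define m where "m = k + sum e I + card I"
  define c :: real where "c = (\<Prod>v\<in>I. fact (e v)) * fact k / fact m"
  have c0: "0 \<le> c" by (auto simp: c_def intro!: prod_nonneg divide_nonneg_nonneg mult_nonneg_nonneg)
  have meas: "(\<lambda>t. ennreal (F J s t)) \<in> borel_measurable (\<Pi>\<^sub>M v\<in>J. lborel)" if "finite J" for J s
  proof -
    show ?thesis
      using that unfolding F_def S_def indicator_def of_bool_def mem_Collect_eq by measurable
  qed
  have S: "x(b := y) \<in> S (insert b I) s \<longleftrightarrow> y \<in> {0..s} \<and> x \<in> S I (s - y)" for x y
    using insert.hyps sum_nonneg[of I x] by (force simp: S_def sum_delta_notmem algebra_simps)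
  have step: "F (insert b I) s (x(b := y)) = indicator {0..s} y * y ^ e b * F I (s - y) x" for x y
  proof -
    have "(\<Prod>v\<in>I. (x(b := y)) v ^ e v) = (\<Prod>v\<in>I. x v ^ e v)" "sum (x(b := y)) I = sum x I"
      using insert.hyps by (auto intro!: prod.cong sum.cong)
    then show ?thesis
      using insert.hyps by (auto simp: F_def S indicator_def algebra_simps)
  qed
  have "(\<integral>\<^sup>+ t. ennreal (F (insert b I) s t) \<partial>(\<Pi>\<^sub>M v\<in>insert b I. lborel)) =
     (\<integral>\<^sup>+ y. \<integral>\<^sup>+ x. ennreal (indicator {0..s} y * y ^ e b) * ennreal (F I (s - y) x) \<partial>(\<Pi>\<^sub>M v\<in>I. lborel) \<partial>lborel)"
    using insert.hyps meas[of "insert b I" s]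
    by (subst product_nn_integral_insert_rev)
      (auto simp: step ennreal_mult' indicator_def intro!: nn_integral_cong)
  also have "\<dots> = (\<integral>\<^sup>+ y. ennreal (indicator {0..s} y * y ^ e b) *
       (\<integral>\<^sup>+ x. ennreal (F I (s - y) x) \<partial>(\<Pi>\<^sub>M v\<in>I. lborel)) \<partial>lborel)"
    by (intro nn_integral_cong nn_integral_cmult meas insert.hyps)
  also have "\<dots> = (\<integral>\<^sup>+ y. ennreal c * ennreal (indicator {0..s} y * (y ^ e b * (s - y) ^ m)) \<partial>lborel)"
  proof (intro nn_integral_cong)
    fix y :: real
    show "ennreal (indicator {0..s} y * y ^ e b) * (\<integral>\<^sup>+ x. ennreal (F I (s - y) x) \<partial>(\<Pi>\<^sub>M v\<in>I. lborel)) =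
      ennreal c * ennreal (indicator {0..s} y * (y ^ e b * (s - y) ^ m))"
    proof (cases "y \<in> {0..s}")
      case True
      then have "(\<integral>\<^sup>+ x. ennreal (F I (s - y) x) \<partial>(\<Pi>\<^sub>M v\<in>I. lborel)) = ennreal (c * (s - y) ^ m)"
        using insert.IH[of "s - y"] by (simp add: F_def S_def c_def m_def)
      then show ?thesis using True c0 by (simp add: ennreal_mult'[symmetric] algebra_simps)
    qed simp
  qed
  also have "\<dots> = ennreal c * (\<integral>\<^sup>+ y. ennreal (indicator {0..s} y * (y ^ e b * (s - y) ^ m)) \<partial>lborel)"
    by (intro nn_integral_cmult) measurable
  also have "\<dots> = ennreal (c * (fact (e b) * fact m / fact (e b + m + 1) * s ^ (e b + m + 1)))"
    by (simp only: nn_integral_Beta_nat[OF insert.prems] ennreal_mult'[OF c0])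
  also have "c * (fact (e b) * fact m / fact (e b + m + 1) * s ^ (e b + m + 1)) =
     (\<Prod>v\<in>insert b I. fact (e v)) * fact k / fact (k + sum e (insert b I) + card (insert b I)) *
            s ^ (k + sum e (insert b I) + card (insert b I))"
  proof -
    have "e b + m + 1 = k + sum e (insert b I) + card (insert b I)"
      using insert.hyps by (simp add: m_def)
    then show ?thesis using insert.hyps by (simp add: c_def field_simps)
  qed
  finally show ?case by (simp add: F_def S_def)
qed

lemma sets_bary_simplex [measurable]:
  assumes "finite I" shows "bary_simplex I \<in> sets (bary_space I)"
proof -
  have "{t \<in> space (\<Pi>\<^sub>M v\<in>I. lborel). (\<forall>v\<in>I. 0 \<le> t v) \<and> (\<Sum>v\<in>I. t v) \<le> (1::real)} \<in> sets (\<Pi>\<^sub>M v\<in>I. lborel)"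
    using assms by measurable
  then show ?thesis by (simp add: bary_simplex_def bary_space_def)
qed

text \<open>The points of the unit simplex over \<open>I\<close>, completed by the barycentric coordinate of the base vertex \<open>a\<close>. The formulas
below then treat all vertices in the same way.\<close>

definition bary_coord :: "'a \<Rightarrow> 'a set \<Rightarrow> ('a \<Rightarrow> real) \<Rightarrow> 'a \<Rightarrow> real" where
  "bary_coord a I t = t(a := 1 - sum t I)"

lemma dirichlet_integral:
  assumes "finite I" "a \<notin> I"
  shows "set_integrable (bary_space I) (bary_simplex I) (\<lambda>t. \<Prod>v\<in>insert a I. bary_coord a I t v ^ e v)"
    and "(LINT t : bary_simplex I | bary_space I. \<Prod>v\<in>insert a I. bary_coord a I t v ^ e v) =
           (\<Prod>v\<in>insert a I. fact (e v)) / fact (sum e (insert a I) + card I)"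
proof -
  let ?M = "\<Pi>\<^sub>M v\<in>I. (lborel :: real measure)"
  let ?f = "\<lambda>t. indicator (bary_simplex I) t *\<^sub>R (\<Prod>v\<in>insert a I. bary_coord a I t v ^ e v)"
  let ?x = "(\<Prod>v\<in>insert a I. fact (e v)) / fact (sum e (insert a I) + card I) :: real"
  have eq: "?f t = indicator {t. (\<forall>v\<in>I. 0 \<le> t v) \<and> sum t I \<le> 1} t *
            ((\<Prod>v\<in>I. t v ^ e v) * (1 - sum t I) ^ e a)" if "t \<in> space ?M" for t
  proof -
    have "(\<Prod>v\<in>I. bary_coord a I t v ^ e v) = (\<Prod>v\<in>I. t v ^ e v)"
      using assms by (auto simp: bary_coord_def intro!: prod.cong)
    then show ?thesis
      using assms that by (auto simp: bary_simplex_def bary_space_def bary_coord_def indicator_def)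
  qed
  have "(\<lambda>t. (if (\<forall>v\<in>I. 0 \<le> t v) \<and> sum t I \<le> 1 then 1 else 0) *
       ((\<Prod>v\<in>I. t v ^ e v) * (1 - sum t I) ^ e a)) \<in> borel_measurable ?M"
    using assms(1) by measurable
  then have "?f \<in> borel_measurable ?M"
    by (rule measurable_cong[THEN iffD1, rotated]) (subst eq, auto simp: indicator_def)
  moreover have "(\<integral>\<^sup>+ t. ennreal (?f t) \<partial>?M) = ennreal ?x"
  proof -
    have "(\<integral>\<^sup>+ t. ennreal (?f t) \<partial>?M) =
        (\<integral>\<^sup>+ t. ennreal (indicator {t. (\<forall>v\<in>I. 0 \<le> t v) \<and> sum t I \<le> 1} t *
            ((\<Prod>v\<in>I. t v ^ e v) * (1 - sum t I) ^ e a)) \<partial>?M)"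
      by (intro nn_integral_cong) (simp only: eq)
    also have "\<dots> = ennreal ?x"
      using dirichlet_nn_integral[OF assms(1), of 1 e "e a"] assms by (simp add: ac_simps)
    finally show ?thesis .
  qed
  moreover have "AE t in ?M. 0 \<le> ?f t"
    by (rule AE_I2) (subst eq, auto simp: indicator_def intro!: mult_nonneg_nonneg prod_nonneg)
  moreover have "0 \<le> ?x" by (intro divide_nonneg_nonneg prod_nonneg) auto
  ultimately have "integrable ?M ?f \<and> integral\<^sup>L ?M ?f = ?x"
    using nn_integral_eq_integrable by blast
  then show "set_integrable (bary_space I) (bary_simplex I) (\<lambda>t. \<Prod>v\<in>insert a I. bary_coord a I t v ^ e v)"
    and "(LINT t : bary_simplex I | bary_space I. \<Prod>v\<in>insert a I. bary_coord a I t v ^ e v) = ?x"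
    by (simp_all add: set_integrable_def set_lebesgue_integral_def bary_space_def)
qed

lemma bary_simplex_measure:
  assumes "finite I"
  shows "emeasure (bary_space I) (bary_simplex I) = ennreal (1 / fact (card I))"
    and "measure (bary_space I) (bary_simplex I) = 1 / fact (card I)"
proof -
  have "emeasure (bary_space I) (bary_simplex I) = (\<integral>\<^sup>+ t. indicator (bary_simplex I) t \<partial>bary_space I)"
    using assms by simp
  also have "\<dots> = (\<integral>\<^sup>+ t. ennreal (indicator {t. (\<forall>v\<in>I. 0 \<le> t v) \<and> sum t I \<le> 1} t) \<partial>bary_space I)"
    by (intro nn_integral_cong) (auto simp: bary_simplex_def indicator_def)
  also have "\<dots> = ennreal (1 / fact (card I))"
    using dirichlet_nn_integral[OF assms, of 1 "\<lambda>_. 0" 0] by (simp add: bary_space_def)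
  finally show "emeasure (bary_space I) (bary_simplex I) = ennreal (1 / fact (card I))" .
  then show "measure (bary_space I) (bary_simplex I) = 1 / fact (card I)"
    by (simp add: measure_def)
qed

text \<open>The fraction of Dirichlet's formula has the numerator \<open>3!\<close>, \<open>2!\<close> or \<open>1\<close> when three, two or no two of the indices
coincide. Writing it as a sum of indicators lets the sums over the three indices factor.\<close>

lemma cubic_moment:
  assumes "finite I" "a \<notin> I" "u \<in> insert a I" "v \<in> insert a I" "w \<in> insert a I"
  defines "F \<equiv> \<lambda>t. bary_coord a I t u * bary_coord a I t v * bary_coord a I t w"
  shows "set_integrable (bary_space I) (bary_simplex I) F"
    and "(LINT t : bary_simplex I | bary_space I. F t) =
           (1 + of_bool (u = v) + of_bool (v = w) + of_bool (u = w) + 2 * of_bool (u = v \<and> v = w))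
             / fact (card I + 3)"
proof -
  define J where "J = insert a I"
  define e :: "'a \<Rightarrow> nat" where "e x = of_bool (x = u) + of_bool (x = v) + of_bool (x = w)" for x
  have J: "finite J" "u \<in> J" "v \<in> J" "w \<in> J" using assms by (auto simp: J_def)
  have pow: "(\<Prod>x\<in>J. l x ^ of_bool (x = z)) = (l z :: real)" if "z \<in> J" for l :: "'a \<Rightarrow> real" and z
  proof -
    have "(\<Prod>x\<in>J. l x ^ of_bool (x = z)) = (\<Prod>x\<in>J. if x = z then l x else 1)"
      by (intro prod.cong) auto
    then show ?thesis using J that by simp
  qed
  have F: "F = (\<lambda>t. \<Prod>x\<in>J. bary_coord a I t x ^ e x)"
    using J by (simp add: F_def e_def power_add prod.distrib pow)
  have "sum e J = 3"
    using J by (simp add: e_def sum.distrib of_bool_def)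
  moreover have "(\<Prod>x\<in>J. fact (e x)) = (\<Prod>x\<in>{u, v, w}. fact (e x) :: real)"
    using J by (intro prod.mono_neutral_right) (auto simp: e_def)
  moreover have "(\<Prod>x\<in>{u, v, w}. fact (e x) :: real) =
      1 + of_bool (u = v) + of_bool (v = w) + of_bool (u = w) + 2 * of_bool (u = v \<and> v = w)"
    by (cases "u = v"; cases "v = w"; cases "u = w") (auto simp: e_def fact_numeral insert_commute)
  ultimately show "set_integrable (bary_space I) (bary_simplex I) F"
    and "(LINT t : bary_simplex I | bary_space I. F t) =
           (1 + of_bool (u = v) + of_bool (v = w) + of_bool (u = w) + 2 * of_bool (u = v \<and> v = w))
             / fact (card I + 3)"
    using dirichlet_integral[OF assms(1,2), of e] unfolding F J_def by (simp_all add: ac_simps)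
qed

section \<open>Averages over a simplex\<close>

lemma bary_point_eq:
  fixes a :: "'a :: real_vector"
  assumes "finite I" "a \<notin> I"
  shows "a + (\<Sum>v\<in>I. t v *\<^sub>R (v - a)) = (\<Sum>v\<in>insert a I. bary_coord a I t v *\<^sub>R v)"
proof -
  have "(\<Sum>v\<in>I. bary_coord a I t v *\<^sub>R v) = (\<Sum>v\<in>I. t v *\<^sub>R v)"
    using assms by (intro sum.cong) (auto simp: bary_coord_def)
  then show ?thesis
    using assms
    by (simp add: bary_coord_def scaleR_diff_right scaleR_diff_left sum_subtractf scaleR_left.sum algebra_simps)
qed

lemma bary_coord_sum:
  assumes "finite I" "a \<notin> I"
  shows "(\<Sum>v\<in>insert a I. bary_coord a I t v) = 1"
proof -
  have "(\<Sum>v\<in>I. bary_coord a I t v) = sum t I"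
    using assms by (intro sum.cong) (auto simp: bary_coord_def)
  then show ?thesis using assms by (simp add: bary_coord_def)
qed

lemma bary_point_in_hull:
  fixes a :: "'a :: real_vector"
  assumes "finite I" "a \<notin> I" "t \<in> bary_simplex I"
  shows "a + (\<Sum>v\<in>I. t v *\<^sub>R (v - a)) \<in> convex hull (insert a I)"
  unfolding bary_point_eq[OF assms(1,2)]
  using assms bary_coord_sum[OF assms(1,2), of t]
  by (intro convex_sum convex_convex_hull) (auto simp: bary_coord_def bary_simplex_def hull_inc)

lemma bary_integrable:
  fixes U :: "'a :: euclidean_space \<Rightarrow> real"
  assumes "finite I" "a \<notin> I" "continuous_on UNIV U"
  shows "set_integrable (bary_space I) (bary_simplex I) (\<lambda>t. U (a + (\<Sum>v\<in>I. t v *\<^sub>R (v - a))))"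
proof -
  have "compact (convex hull (insert a I))"
    using assms(1) by (intro compact_convex_hull finite_imp_compact) auto
  then have "bounded (U ` (convex hull (insert a I)))"
    using assms(3) by (intro compact_imp_bounded compact_continuous_image)
       (auto intro: continuous_on_subset)
  then obtain B where B: "\<And>x. x \<in> convex hull (insert a I) \<Longrightarrow> norm (U x) \<le> B"
    unfolding bounded_iff by auto
  have [measurable]: "U \<in> borel_measurable borel"
    using assms(3) by (rule borel_measurable_continuous_onI)
  show ?thesis
    unfolding set_integrable_def
  proof (rule integrableI_bounded_set_indicator)
    show "bary_simplex I \<in> sets (bary_space I)" using assms(1) by measurable
    show "(\<lambda>t. U (a + (\<Sum>v\<in>I. t v *\<^sub>R (v - a)))) \<in> borel_measurable (bary_space I)"
      unfolding bary_space_def using assms(1) by measurable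
    show "emeasure (bary_space I) (bary_simplex I) < \<infinity>"
      using assms(1) by (simp add: bary_simplex_measure)
    show "AE t in bary_space I. t \<in> bary_simplex I \<longrightarrow> norm (U (a + (\<Sum>v\<in>I. t v *\<^sub>R (v - a)))) \<le> B"
      using B bary_point_in_hull[OF assms(1,2)] by (intro AE_I2) auto
  qed
qed

text \<open>The base vertex that \<open>simplex_avg\<close> chooses is known only to be some vertex; all computations below are uniform in it.\<close>

lemma simplex_avg_parametrized:
  fixes W :: "(real ^ 'n) set"
  assumes "finite W" "W \<noteq> {}"
  obtains a I where "finite I" "a \<notin> I" "W = insert a I"
    "\<And>U. simplex_avg W U = (LINT t : bary_simplex I | bary_space I. U (a + (\<Sum>v\<in>I. t v *\<^sub>R (v - a))))
        / measure (bary_space I) (bary_simplex I)"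
proof
  let ?a = "SOME a. a \<in> W"
  have "?a \<in> W" using assms(2) by (simp add: some_in_eq)
  then show "W = insert ?a (W - {?a})" by auto
  show "finite (W - {?a})" using assms by simp
  show "?a \<notin> W - {?a}" by simp
qed (simp add: simplex_avg_def Let_def)

lemma simplex_avg_add:
  fixes W :: "(real ^ 'n) set"
  assumes "finite W" "W \<noteq> {}" "continuous_on UNIV U" "continuous_on UNIV U'"
  shows "simplex_avg W (\<lambda>x. U x + U' x) = simplex_avg W U + simplex_avg W U'"
  by (rule simplex_avg_parametrized[OF assms(1,2)])
     (simp add: bary_integrable assms add_divide_distrib)

lemma simplex_avg_mult:
  fixes W :: "(real ^ 'n) set"
  assumes "finite W" "W \<noteq> {}"
  shows "simplex_avg W (\<lambda>x. c * U x) = c * simplex_avg W U"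
  by (rule simplex_avg_parametrized[OF assms]) simp

definition affine_fun :: "('a :: real_vector \<Rightarrow> real) \<Rightarrow> bool" where
  "affine_fun f \<longleftrightarrow> (\<exists>c g. linear g \<and> f = (\<lambda>x. c + g x))"

lemma affine_fun_combination:
  assumes "affine_fun f" "sum l W = 1"
  shows "f (\<Sum>v\<in>W. l v *\<^sub>R v) = (\<Sum>v\<in>W. l v * f v)"
proof -
  obtain c g where g: "linear g" "f = (\<lambda>x. c + g x)" using assms(1) by (auto simp: affine_fun_def)
  show ?thesis
    using assms(2) by (simp add: g linear_sum linear_scale distrib_left sum.distrib sum_distrib_right[symmetric])
qed

lemma affine_fun_continuous:
  fixes f :: "'a :: euclidean_space \<Rightarrow> real"
  assumes "affine_fun f"
  shows "continuous_on A f"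
  using assms by (auto simp: affine_fun_def linear_continuous_on linear_conv_bounded_linear intro!: continuous_intros)

text \<open>The function \<open>f\<close> is the combination of its vertex values with the barycentric coordinates as coefficients, and so are
\<open>g\<close> and \<open>h\<close>; the product becomes a triple sum of moments. The constant and the four indicators in a moment identify
none, two or all of the three summation indices, which gives the five terms.\<close>

lemma simplex_avg_affine3:
  fixes W :: "(real ^ 'n) set"
  assumes W: "finite W" "W \<noteq> {}" and aff: "affine_fun f" "affine_fun g" "affine_fun h"
  defines "k \<equiv> real (card W)"
  shows "simplex_avg W (\<lambda>x. f x * g x * h x) =
    (sum f W * sum g W * sum h W + sum f W * (\<Sum>v\<in>W. g v * h v) + sum g W * (\<Sum>v\<in>W. f v * h v)
      + sum h W * (\<Sum>v\<in>W. f v * g v) + 2 * (\<Sum>v\<in>W. f v * g v * h v)) / (k * (k + 1) * (k + 2))"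
proof (rule simplex_avg_parametrized[OF W])
  fix a I
  assume I: "finite I" "a \<notin> I" and WI: "W = insert a I"
    and avg: "\<And>U. simplex_avg W U = (LINT t : bary_simplex I | bary_space I. U (a + (\<Sum>v\<in>I. t v *\<^sub>R (v - a))))
        / measure (bary_space I) (bary_simplex I)"
  let ?l = "bary_coord a I"
  let ?F = "\<lambda>(u, v, w) t. ?l t u * ?l t v * ?l t w"
  let ?c = "\<lambda>(u, v, w). f u * g v * h w"
  have exp: "f x * g x * h x = (\<Sum>p\<in>W \<times> W \<times> W. ?c p * ?F p t)"
    if "x = a + (\<Sum>v\<in>I. t v *\<^sub>R (v - a))" for x t
  proof -
    have e: "q x = (\<Sum>v\<in>W. ?l t v * q v)" if "affine_fun q" for q
      using bary_point_eq[OF I, of t] affine_fun_combination[OF that, of "?l t" W] bary_coord_sum[OF I, of t]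
      by (simp add: \<open>x = _\<close> WI)
    have "f x * g x * h x = (\<Sum>u\<in>W. \<Sum>v\<in>W. \<Sum>w\<in>W. (?l t u * f u) * ((?l t v * g v) * (?l t w * h w)))"
      unfolding mult.assoc[of "f x"] unfolding e[OF aff(1)] e[OF aff(2)] e[OF aff(3)]
      by (simp only: sum_product) (simp only: sum_distrib_left)
    then show ?thesis
      by (simp add: sum.cartesian_product split_beta' mult_ac)
  qed
  let ?A = "\<lambda>u v. of_bool (u = v) :: real"
  have "(LINT t : bary_simplex I | bary_space I. \<Sum>p\<in>W \<times> W \<times> W. ?c p * ?F p t) =
      (\<Sum>p\<in>W \<times> W \<times> W. ?c p * (LINT t : bary_simplex I | bary_space I. ?F p t))"
  proof -
    have "set_integrable (bary_space I) (bary_simplex I) (?F p)" if "p \<in> W \<times> W \<times> W" for p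
      using cubic_moment(1)[OF I] that by (auto simp: WI split_beta)
    then show ?thesis
      unfolding set_lebesgue_integral_def set_integrable_def
      by (simp add: sum_distrib_left mult.left_commute[of "indicator _ _"])
  qed
  also have "\<dots> = (\<Sum>p\<in>W \<times> W \<times> W. ?c p * ((\<lambda>(u, v, w). 1 + ?A u v + ?A v w + ?A u w + 2 * (?A u v * ?A v w)) p / fact (card I + 3)))"
    using cubic_moment(2)[OF I] by (intro sum.cong) (auto simp: WI split_beta of_bool_conj)
  also have "\<dots> = (\<Sum>u\<in>W. \<Sum>v\<in>W. \<Sum>w\<in>W. f u * g v * h w * (1 + ?A u v + ?A v w + ?A u w + 2 * (?A u v * ?A v w))) / fact (card I + 3)"
    by (simp add: sum.cartesian_product split_beta' sum_divide_distrib)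
  \<comment> \<open>The indicators are summed out one index at a time, from the inside.\<close>
  also have "(\<Sum>u\<in>W. \<Sum>v\<in>W. \<Sum>w\<in>W. f u * g v * h w * (1 + ?A u v + ?A v w + ?A u w + 2 * (?A u v * ?A v w)))
     = sum f W * sum g W * sum h W + sum f W * (\<Sum>v\<in>W. g v * h v) + sum g W * (\<Sum>v\<in>W. f v * h v)
      + sum h W * (\<Sum>v\<in>W. f v * g v) + 2 * (\<Sum>v\<in>W. f v * g v * h v)" (is "?L = ?R")
  proof -
    have d: "(\<Sum>v\<in>W. ?A u v * q v) = q u" if "u \<in> W" for u q
      using W that by (simp add: of_bool_def if_distrib[of "\<lambda>x. x * _"] cong: if_cong)
    have "?L = (\<Sum>u\<in>W. f u * (\<Sum>v\<in>W. g v * (sum h W + ?A u v * sum h W + h v + h u + 2 * (?A u v * h v))))"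
    proof (intro sum.cong refl, subst sum_distrib_left, intro sum.cong refl)
      fix u v assume uv: "u \<in> W" "v \<in> W"
      have "(\<Sum>w\<in>W. f u * g v * h w * (1 + ?A u v + ?A v w + ?A u w + 2 * (?A u v * ?A v w))) =
        f u * g v * (sum h W + ?A u v * sum h W + (\<Sum>w\<in>W. ?A v w * h w) + (\<Sum>w\<in>W. ?A u w * h w)
           + 2 * (?A u v * (\<Sum>w\<in>W. ?A v w * h w)))"
        by (simp add: sum_distrib_left sum.distrib algebra_simps)
      then show "(\<Sum>w\<in>W. f u * g v * h w * (1 + ?A u v + ?A v w + ?A u w + 2 * (?A u v * ?A v w))) =
        f u * (g v * (sum h W + ?A u v * sum h W + h v + h u + 2 * (?A u v * h v)))"
        using uv by (simp add: d mult.assoc)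
    qed
    also have "\<dots> = (\<Sum>u\<in>W. f u * (sum g W * sum h W + g u * sum h W + (\<Sum>v\<in>W. g v * h v) + sum g W * h u + 2 * (g u * h u)))"
    proof (intro sum.cong refl arg_cong2[where f = "(*)"])
      fix u assume u: "u \<in> W"
      have "(\<Sum>v\<in>W. g v * (H + ?A u v * H + h v + h u + 2 * (?A u v * h v))) =
        sum g W * H + (\<Sum>v\<in>W. ?A u v * g v) * H + (\<Sum>v\<in>W. g v * h v) + sum g W * h u
          + 2 * (\<Sum>v\<in>W. ?A u v * (g v * h v))" for H
        by (simp add: sum_distrib_left sum_distrib_right sum.distrib algebra_simps)
      then show "(\<Sum>v\<in>W. g v * (sum h W + ?A u v * sum h W + h v + h u + 2 * (?A u v * h v))) =
        sum g W * sum h W + g u * sum h W + (\<Sum>v\<in>W. g v * h v) + sum g W * h u + 2 * (g u * h u)"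
        using u by (simp add: d)
    qed
    also have "\<dots> = ?R"
    proof -
      have "(\<Sum>u\<in>W. f u * (G * H + g u * H + X + G * h u + 2 * (g u * h u))) =
        sum f W * G * H + sum f W * X + G * (\<Sum>v\<in>W. f v * h v) + H * (\<Sum>v\<in>W. f v * g v)
          + 2 * (\<Sum>v\<in>W. f v * g v * h v)" for G H X
        by (simp add: sum_distrib_left sum_distrib_right sum.distrib algebra_simps)
      then show ?thesis .
    qed
    finally show ?thesis .
  qed
  finally have "(LINT t : bary_simplex I | bary_space I. \<Sum>p\<in>W \<times> W \<times> W. ?c p * ?F p t) = ?R / fact (card I + 3)" .
  moreover have "k = real (card I) + 1" using I by (simp add: k_def WI)
  ultimately show ?thesis
    using I by (simp add: avg exp[OF refl] bary_simplex_measure numeral_3_eq_3)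
qed

section \<open>The cell average in barycentric coordinates\<close>

lemma sum_scale_Basis_inner:
  fixes b :: "'i \<Rightarrow> 'a :: euclidean_space"
  assumes "bij_betw b I Basis" "u \<in> I"
  shows "(\<Sum>v\<in>I. t v *\<^sub>R b v) \<bullet> b u = t u"
proof -
  have "(\<Sum>v\<in>I. t v *\<^sub>R b v) \<bullet> b u = (\<Sum>v\<in>I. if v = u then t v else 0)"
    unfolding inner_sum_left inner_scaleR_left
  proof (intro sum.cong refl)
    fix v assume "v \<in> I"
    then have "b v \<in> Basis" "b u \<in> Basis" "b v = b u \<longleftrightarrow> v = u"
      using assms by (auto simp: bij_betw_def inj_on_def)
    then show "t v * (b v \<bullet> b u) = (if v = u then t v else 0)"
      by (simp add: inner_Basis)
  qed
  moreover have "finite I" using bij_betw_finite[OF assms(1)] by simp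
  ultimately show ?thesis using assms(2) by simp
qed

text \<open>The product measure indexed by the vertices is Lebesgue measure once the indices are identified with an orthonormal
basis: boxes are products of intervals on both sides.\<close>

lemma distr_bary_space_Basis:
  fixes b :: "'i \<Rightarrow> 'a :: euclidean_space"
  assumes "bij_betw b I Basis"
  shows "distr (bary_space I) borel (\<lambda>t. \<Sum>v\<in>I. t v *\<^sub>R b v) = lborel"
proof (rule lborel_eqI[symmetric])
  have fin: "finite I" using bij_betw_finite[OF assms] by simp
  interpret product_sigma_finite "\<lambda>_. lborel :: real measure" by standard
  let ?\<Phi> = "\<lambda>t. \<Sum>v\<in>I. t v *\<^sub>R b v"
  note \<Phi> = sum_scale_Basis_inner[OF assms]
  fix l u :: 'a
  assume lu: "\<And>c. c \<in> Basis \<Longrightarrow> l \<bullet> c \<le> u \<bullet> c"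
  have B: "Basis = b ` I" using assms by (simp add: bij_betw_def)
  have le: "l \<bullet> b v \<le> u \<bullet> b v" if "v \<in> I" for v
    using lu[of "b v"] that by (simp add: B)
  have "?\<Phi> -` box l u \<inter> space (bary_space I) = (\<Pi>\<^sub>E v\<in>I. {l \<bullet> b v <..< u \<bullet> b v})"
    by (auto simp: box_def B \<Phi> bary_space_def space_PiM PiE_iff)
  moreover have "?\<Phi> \<in> measurable (bary_space I) borel"
    unfolding bary_space_def using fin by measurable
  ultimately have "emeasure (distr (bary_space I) borel ?\<Phi>) (box l u) =
      emeasure (bary_space I) (\<Pi>\<^sub>E v\<in>I. {l \<bullet> b v <..< u \<bullet> b v})"
    by (simp add: emeasure_distr)
  also have "\<dots> = (\<Prod>v\<in>I. ennreal ((u - l) \<bullet> b v))"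
    using le fin by (simp add: bary_space_def emeasure_PiM inner_diff_left)
  also have "\<dots> = (\<Prod>c\<in>Basis. ennreal ((u - l) \<bullet> c))"
    using assms by (rule prod.reindex_bij_betw)
  also have "\<dots> = ennreal (\<Prod>c\<in>Basis. (u - l) \<bullet> c)"
    using lu by (intro prod_ennreal) (simp add: inner_diff_left)
  finally show "emeasure (distr (bary_space I) borel ?\<Phi>) (box l u) = ennreal (\<Prod>c\<in>Basis. (u - l) \<bullet> c)" .
qed simp

text \<open>The change of variables theorem concerns vector-valued integrands, so the real integrand is embedded into
\<open>real ^ 1\<close>.\<close>

lemma integral_affine_image:
  fixes L :: "real ^ 'n :: {finite, wellorder} \<Rightarrow> real ^ 'n::_" and U :: "real ^ 'n::_ \<Rightarrow> real"
  assumes "linear L" "inj L" "compact S" "continuous_on UNIV U"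
  shows "integral ((\<lambda>y. a + L y) ` S) U = \<bar>det (matrix L)\<bar> * integral S (\<lambda>y. U (a + L y))"
proof -
  let ?g = "\<lambda>y. a + L y"
  let ?vec = "\<lambda>x. vec x :: real ^ 1"
  have cL: "continuous_on A ?g" for A
    using assms(1) by (intro continuous_intros) (simp add: linear_continuous_on linear_conv_bounded_linear)
  have cU: "continuous_on A (\<lambda>x. ?vec (U x))" for A
    unfolding vec_def by (intro continuous_on_vec_lambda continuous_on_subset[OF assms(4)]) auto
  have cpt: "compact (?g ` S)" using assms(3) cL by (intro compact_continuous_image)
  have abs: "f absolutely_integrable_on K" if "compact K" "continuous_on K f" for f :: "real ^ 'n::_ \<Rightarrow> real ^ 1" and K
    using borel_integrable_compact[OF that] by (simp add: set_integrable_def integrable_completion)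
  have fin: "U integrable_on K" if "compact K" "continuous_on UNIV U" for K and U :: "real ^ 'n::_ \<Rightarrow> real"
    using borel_integrable_compact[OF that(1) continuous_on_subset[OF that(2)]]
    by (intro set_borel_integral_eq_integral(1)) (simp add: set_integrable_def)
  have der: "(?g has_derivative L) (at y within S)" for y
    using has_derivative_add[OF has_derivative_const[of a] linear_imp_has_derivative[OF assms(1)]] by simp
  have "integral (?g ` S) (\<lambda>x. ?vec (U x)) = integral S (\<lambda>y. \<bar>det (matrix L)\<bar> *\<^sub>R ?vec (U (?g y)))"
  proof (rule integral_change_of_variables)
    show "S \<in> sets lebesgue" using assms(3) by (simp add: compact_imp_closed lmeasurable_compact fmeasurableD)
    show "(?g has_derivative L) (at y within S)" for y by (rule der)
    show "inj_on ?g S" using assms(2) by (auto simp: inj_on_def)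
  qed (use abs[OF cpt cU] in blast)
  moreover have "(\<lambda>x. ?vec (U x)) integrable_on ?g ` S"
    using abs[OF cpt cU] by (rule set_lebesgue_integral_eq_integral(1))
  moreover have "(\<lambda>y. \<bar>det (matrix L)\<bar> *\<^sub>R ?vec (U (?g y))) integrable_on S"
    by (intro integrable_cmul set_lebesgue_integral_eq_integral(1) abs assms(3)
        continuous_on_compose2[OF cU[of UNIV] cL]) simp
  ultimately have "integral (?g ` S) (\<lambda>x. ?vec (U x) $ 1) =
      integral S (\<lambda>y. (\<bar>det (matrix L)\<bar> *\<^sub>R ?vec (U (?g y))) $ 1)"
    by (simp only: integral_component_eq_cart)
  then show ?thesis by simp
qed

text \<open>The cell is the image of the standard simplex under an injective affine map. Its Jacobian is constant and cancels in
the average, and the standard simplex carries the same integrals as the simplex of barycentric coordinates.\<close>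

lemma cell_avg_eq_simplex_avg:
  fixes V :: "(real ^ 'n :: {finite, wellorder}) set"
  assumes V: "simplex_vertices V" and U: "continuous_on UNIV U"
  shows "cell_avg V U = simplex_avg V U"
proof -
  have finV: "finite V" "V \<noteq> {}"
    using V by (auto simp: simplex_vertices_def intro: card_ge_0_finite)
  obtain a I where I: "finite I" "a \<notin> I" "V = insert a I"
    and avg: "\<And>U. simplex_avg V U = (LINT t : bary_simplex I | bary_space I. U (a + (\<Sum>v\<in>I. t v *\<^sub>R (v - a))))
        / measure (bary_space I) (bary_simplex I)"
    by (rule simplex_avg_parametrized[OF finV]) (rule that)
  have cI: "card I = DIM(real ^ 'n::_)" using V I by (simp add: simplex_vertices_def)
  then obtain b :: "real ^ 'n::_ \<Rightarrow> real ^ 'n::_" where b: "bij_betw b I Basis"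
    using finite_same_card_bij[OF I(1), of "Basis :: (real ^ 'n::_) set"] by auto
  obtain L :: "real ^ 'n::_ \<Rightarrow> real ^ 'n::_" where L: "linear L" "\<forall>c\<in>Basis. L c = inv_into I b c - a"
    using linear_independent_extend[OF independent_Basis, of "\<lambda>c. inv_into I b c - a"] by blast
  have Lb: "L (b v) = v - a" if "v \<in> I" for v
  proof -
    have "b v \<in> Basis" "inv_into I b (b v) = v" using that b by (auto simp: bij_betw_def)
    then show ?thesis using L(2) by simp
  qed
  have img: "L ` Basis = (\<lambda>v. v - a) ` I"
    unfolding bij_betw_imp_surj_on[OF b, symmetric] by (simp add: image_image Lb)
  have "\<not> dependent ((\<lambda>v. v - a) ` I)"
    using V I affine_dependent_iff_dependent2[of a V] by (simp add: simplex_vertices_def)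
  moreover have "card ((\<lambda>v. v - a) ` I) = DIM(real ^ 'n::_)"
    using cI by (simp add: card_image inj_on_def)
  ultimately have "span (L ` Basis) = UNIV"
    unfolding img by (simp add: dim_eq_full[symmetric] dim_eq_card_independent)
  \<comment> \<open>The edge vectors at \<open>a\<close> are independent and as many as the dimension, so \<open>L\<close> is invertible.\<close>
  then have "surj L"
    using L(1) by (simp add: linear_span_image)
  then have injL: "inj L" using L(1) by (simp add: linear_surjective_imp_injective)
  then have det: "det (matrix L) \<noteq> 0"
    using L(1) by (simp add: det_nz_iff_inj)
  define S :: "(real ^ 'n::_) set" where "S = convex hull (insert 0 Basis)"
  have S: "S = {y. (\<forall>c\<in>Basis. 0 \<le> y \<bullet> c) \<and> (\<Sum>c\<in>Basis. y \<bullet> c) \<le> 1}"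
    unfolding S_def std_simplex by simp
  have cS: "compact S" unfolding S_def by (intro compact_convex_hull finite_imp_compact) auto
  have hull: "(\<lambda>y. a + L y) ` S = convex hull V"
  proof -
    have "(\<lambda>y. a + L y) ` S = (\<lambda>x. a + x) ` (L ` S)" by (simp add: image_image)
    also have "L ` S = convex hull (insert 0 ((\<lambda>v. v - a) ` I))"
      using L(1) by (simp add: S_def convex_hull_linear_image linear_0 img)
    also have "(\<lambda>x. a + x) ` \<dots> = convex hull V"
      by (simp add: convex_hull_translation[symmetric] image_image I(3))
    finally show ?thesis .
  qed
  have par: "(LINT t : bary_simplex I | bary_space I. U (a + (\<Sum>v\<in>I. t v *\<^sub>R (v - a)))) = integral S (\<lambda>y. U (a + L y))"
    if U: "continuous_on UNIV U" for U :: "real ^ 'n::_ \<Rightarrow> real"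
  proof -
    let ?\<Phi> = "\<lambda>t. \<Sum>v\<in>I. t v *\<^sub>R b v"
    have cont: "continuous_on A (\<lambda>y. U (a + L y))" for A
      by (rule continuous_on_compose2[OF U])
         (use L(1) in \<open>auto intro!: continuous_intros simp: linear_continuous_on linear_conv_bounded_linear\<close>)
    have [measurable]: "S \<in> sets borel" using cS by (simp add: borel_compact)
    have [measurable]: "(\<lambda>y. U (a + L y)) \<in> borel_measurable borel"
      by (rule borel_measurable_continuous_onI[OF cont])
    have [measurable]: "?\<Phi> \<in> measurable (bary_space I) borel"
      unfolding bary_space_def using I(1) by measurable
    have "integral S (\<lambda>y. U (a + L y)) = (LINT y : S | lborel. U (a + L y))"
      using borel_integrable_compact[OF cS cont]
      by (intro set_borel_integral_eq_integral(2)[symmetric]) (simp add: set_integrable_def)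
    also have "\<dots> = (LINT t | bary_space I. indicator S (?\<Phi> t) *\<^sub>R U (a + L (?\<Phi> t)))"
      unfolding set_lebesgue_integral_def distr_bary_space_Basis[OF b, symmetric]
      by (rule integral_distr) auto
    also have "\<dots> = (LINT t : bary_simplex I | bary_space I. U (a + (\<Sum>v\<in>I. t v *\<^sub>R (v - a))))"
      unfolding set_lebesgue_integral_def
    proof (intro Bochner_Integration.integral_cong refl)
      fix t assume t: "t \<in> space (bary_space I)"
      note \<Phi> = sum_scale_Basis_inner[OF b]
      have "(\<Sum>c\<in>Basis. ?\<Phi> t \<bullet> c) = (\<Sum>u\<in>I. ?\<Phi> t \<bullet> b u)"
        by (rule sum.reindex_bij_betw[OF b, symmetric])
      then have "(\<Sum>c\<in>Basis. ?\<Phi> t \<bullet> c) = sum t I" by (simp add: \<Phi>)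
      moreover have "(\<forall>c\<in>Basis. 0 \<le> ?\<Phi> t \<bullet> c) \<longleftrightarrow> (\<forall>u\<in>I. 0 \<le> t u)"
        unfolding bij_betw_imp_surj_on[OF b, symmetric] by (simp add: \<Phi>)
      ultimately have "?\<Phi> t \<in> S \<longleftrightarrow> t \<in> bary_simplex I"
        using t by (simp add: S bary_simplex_def)
      moreover have "L (?\<Phi> t) = (\<Sum>v\<in>I. t v *\<^sub>R (v - a))"
        using L(1) by (simp add: linear_sum linear_scale Lb)
      ultimately show "indicator S (?\<Phi> t) *\<^sub>R U (a + L (?\<Phi> t)) =
          indicator (bary_simplex I) t *\<^sub>R U (a + (\<Sum>v\<in>I. t v *\<^sub>R (v - a)))"
        by (simp add: indicator_def)
    qed
    finally show ?thesis ..
  qed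
  have int: "integral (convex hull V) U = \<bar>det (matrix L)\<bar> * integral S (\<lambda>y. U (a + L y))"
    if "continuous_on UNIV U" for U
    unfolding hull[symmetric] by (rule integral_affine_image[OF L(1) injL cS that])
  have "measure lebesgue (convex hull V) = integral (convex hull V) (\<lambda>_. 1 :: real)"
    using finV by (intro lmeasure_integral lmeasurable_compact compact_convex_hull finite_imp_compact)
  moreover have "measure (bary_space I) (bary_simplex I) = integral S (\<lambda>_. 1 :: real)"
    using par[of "\<lambda>_. 1"] I(1) by (simp add: set_lebesgue_integral_def)
  ultimately show ?thesis
    using det by (simp add: cell_avg_def avg par[OF U] int[OF U] int[of "\<lambda>_. 1"])
qed

section \<open>Polynomials as combinations of products of affine functions\<close>

lemma finite_exponents: "finite {e :: 'n :: finite \<Rightarrow> nat. sum e UNIV \<le> d}"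
proof (rule finite_subset)
  show "{e :: 'n \<Rightarrow> nat. sum e UNIV \<le> d} \<subseteq> (\<Pi>\<^sub>E i\<in>UNIV. {..d})"
  proof safe
    fix e :: "'n \<Rightarrow> nat" and i
    assume "sum e UNIV \<le> d"
    then show "e i \<le> d"
      using member_le_sum[of i UNIV e] by simp
  qed auto
qed (simp add: finite_PiE)

lemma polys_upto_monomial:
  assumes "sum e UNIV \<le> d"
  shows "(\<lambda>x. \<Prod>i\<in>UNIV. x $ i ^ e i) \<in> polys_upto d"
proof -
  have "(\<Sum>e' | sum e' UNIV \<le> d. of_bool (e' = e) * (\<Prod>i\<in>UNIV. x $ i ^ e' i)) =
      (\<Prod>i\<in>UNIV. x $ i ^ e i)" for x :: "real ^ 'a"
    using assms by (simp add: finite_exponents of_bool_def if_distrib[of "\<lambda>x. x * _"] cong: if_cong)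
  then show ?thesis
    unfolding polys_upto_def by (intro CollectI exI[of _ "\<lambda>e'. of_bool (e' = e)"]) simp
qed

lemma polys_upto_add:
  assumes "U \<in> polys_upto d" "U' \<in> polys_upto d"
  shows "(\<lambda>x. U x + U' x) \<in> polys_upto d"
proof -
  obtain c c' where "U = (\<lambda>x. \<Sum>e | sum e UNIV \<le> d. c e * (\<Prod>i\<in>UNIV. x $ i ^ e i))"
    "U' = (\<lambda>x. \<Sum>e | sum e UNIV \<le> d. c' e * (\<Prod>i\<in>UNIV. x $ i ^ e i))"
    using assms by (auto simp: polys_upto_def)
  then show ?thesis
    unfolding polys_upto_def
    by (intro CollectI exI[of _ "\<lambda>e. c e + c' e"]) (simp add: sum.distrib distrib_right)
qed

lemma polys_upto_scale:
  assumes "U \<in> polys_upto d"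
  shows "(\<lambda>x. r * U x) \<in> polys_upto d"
proof -
  obtain c where "U = (\<lambda>x. \<Sum>e | sum e UNIV \<le> d. c e * (\<Prod>i\<in>UNIV. x $ i ^ e i))"
    using assms by (auto simp: polys_upto_def)
  then show ?thesis
    unfolding polys_upto_def
    by (intro CollectI exI[of _ "\<lambda>e. r * c e"]) (simp add: sum_distrib_left mult.assoc)
qed

lemma polys_upto_sum:
  assumes "\<And>j. j \<in> A \<Longrightarrow> U j \<in> polys_upto d"
  shows "(\<lambda>x. \<Sum>j\<in>A. U j x) \<in> polys_upto d"
  using assms
proof (induction A rule: infinite_finite_induct)
  case (insert j A)
  then show ?case by (simp add: polys_upto_add)
qed (auto simp: polys_upto_def intro!: exI[of _ "\<lambda>_. 0"])

text \<open>Linear properties of polynomials need to be checked on monomials only.\<close>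

lemma polys_upto_induct [consumes 1, case_names monomial add scale]:
  assumes U: "U \<in> polys_upto d"
    and monomial: "\<And>e. sum e UNIV \<le> d \<Longrightarrow> P (\<lambda>x. \<Prod>i\<in>UNIV. x $ i ^ e i)"
    and add: "\<And>U U'. P U \<Longrightarrow> P U' \<Longrightarrow> P (\<lambda>x. U x + U' x)"
    and scale: "\<And>r U. P U \<Longrightarrow> P (\<lambda>x. r * U x)"
  shows "P U"
proof -
  obtain c where c: "U = (\<lambda>x. \<Sum>e | sum e UNIV \<le> d. c e * (\<Prod>i\<in>UNIV. x $ i ^ e i))"
    using U by (auto simp: polys_upto_def)
  have "P (\<lambda>x. \<Sum>e\<in>A. c e * (\<Prod>i\<in>UNIV. x $ i ^ e i))" if "finite A" "A \<subseteq> {e. sum e UNIV \<le> d}" for A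
    using that
  proof (induction A rule: finite_induct)
    case empty
    show ?case using scale[OF monomial[of "\<lambda>_. 0"], of 0] by simp
  next
    case (insert e A)
    then have "P (\<lambda>x. c e * (\<Prod>i\<in>UNIV. x $ i ^ e i))" by (intro scale monomial) auto
    from add[OF this insert.IH] insert.hyps insert.prems show ?case by simp
  qed
  from this[OF finite_exponents order_refl] show ?thesis by (simp add: c)
qed

lemma polys_upto_continuous:
  assumes "U \<in> polys_upto d"
  shows "continuous_on A U"
  using assms by (induction rule: polys_upto_induct) (auto intro!: continuous_intros)

lemma affine_fun_const: "affine_fun (\<lambda>_. c)"
  unfolding affine_fun_def by (intro exI[of _ c] exI[of _ "\<lambda>_. 0"]) (simp add: linear_zero)

lemma affine_fun_diff:
  assumes "affine_fun f" "affine_fun g"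
  shows "affine_fun (\<lambda>x. f x - g x)"
proof -
  obtain c l c' l' where "linear l" "f = (\<lambda>x. c + l x)" "linear l'" "g = (\<lambda>x. c' + l' x)"
    using assms by (auto simp: affine_fun_def)
  then show ?thesis
    unfolding affine_fun_def
    by (intro exI[of _ "c - c'"] exI[of _ "\<lambda>x. l x - l' x"]) (simp add: linear_compose_sub fun_eq_iff)
qed

lemma affine_fun_coordinate: "affine_fun (\<lambda>x :: real ^ 'n. x $ i)"
  unfolding affine_fun_def
  by (intro exI[of _ 0] exI[of _ "\<lambda>x. x $ i"]) (simp add: bounded_linear.linear bounded_linear_vec_nth)

lemma monomial_coordinate_mult:
  fixes x :: "real ^ 'n"
  shows "(\<Prod>i\<in>UNIV. x $ i ^ (e i + of_bool (i = j))) = x $ j * (\<Prod>i\<in>UNIV. x $ i ^ e i)"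
proof -
  have "(\<Prod>i\<in>UNIV. x $ i ^ of_bool (i = j)) = (\<Prod>i\<in>UNIV. if i = j then x $ i else 1)"
    by (intro prod.cong) auto
  then show ?thesis by (simp add: power_add prod.distrib)
qed

lemma polys_upto_coordinate_mult:
  assumes "U \<in> polys_upto d"
  shows "(\<lambda>x. x $ j * U x) \<in> polys_upto (Suc d)"
  using assms
proof (induction rule: polys_upto_induct)
  case (monomial e)
  let ?e = "\<lambda>i. e i + of_bool (i = j)"
  have "sum ?e UNIV \<le> Suc d" using monomial by (simp add: sum.distrib of_bool_def)
  then show ?case using polys_upto_monomial[of ?e "Suc d"] by (simp add: monomial_coordinate_mult)
next
  case (add U U')
  then show ?case using polys_upto_add by (fastforce simp: distrib_left)
next
  case (scale r U)
  then show ?case using polys_upto_scale[of _ _ r] by (fastforce simp: mult.left_commute)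
qed

lemma polys_upto_Suc:
  assumes "U \<in> polys_upto d"
  shows "U \<in> polys_upto (Suc d)"
  using assms
  by (induction rule: polys_upto_induct) (auto intro: polys_upto_monomial polys_upto_add polys_upto_scale)

lemma polys_upto_affine_mult:
  fixes U :: "real ^ 'n \<Rightarrow> real"
  assumes "affine_fun f" "U \<in> polys_upto d"
  shows "(\<lambda>x. f x * U x) \<in> polys_upto (Suc d)"
proof -
  obtain c g where g: "linear g" "f = (\<lambda>x. c + g x)" using assms(1) by (auto simp: affine_fun_def)
  have gx: "g x = (\<Sum>i\<in>UNIV. x $ i * g (axis i 1))" for x
  proof -
    have "g x = g (\<Sum>i\<in>UNIV. x $ i *\<^sub>R axis i 1)"
      using basis_expansion[of x] by (simp add: scalar_mult_eq_scaleR)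
    then show ?thesis using g(1) by (simp add: linear_sum linear_scale)
  qed
  have "f x * U x = c * U x + (\<Sum>i\<in>UNIV. g (axis i 1) * (x $ i * U x))" for x
    using gx[of x] by (simp add: g(2) algebra_simps sum_distrib_left)
  then show ?thesis
    using assms(2)
    by (simp only:) (intro polys_upto_add polys_upto_sum polys_upto_scale polys_upto_coordinate_mult polys_upto_Suc)
qed

lemma affine3_in_polys_upto:
  fixes f g h :: "real ^ 'n \<Rightarrow> real"
  assumes "affine_fun f" "affine_fun g" "affine_fun h"
  shows "(\<lambda>x. f x * g x * h x) \<in> polys_upto 3"
proof -
  have "(\<lambda>_. 1) \<in> (polys_upto 0 :: (real ^ 'n \<Rightarrow> real) set)"
    using polys_upto_monomial[of "\<lambda>_. 0" 0] by simp
  from polys_upto_affine_mult[OF assms(1) polys_upto_affine_mult[OF assms(2) polys_upto_affine_mult[OF assms(3) this]]]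
  show ?thesis by (simp add: numeral_3_eq_3 mult.assoc)
qed

text \<open>The factors are coordinates, padded with constants \<open>1\<close> if the degree is less than \<open>d\<close>.\<close>

lemma monomial_affine_factors:
  fixes e :: "'n :: finite \<Rightarrow> nat"
  assumes "sum e UNIV \<le> d"
  shows "\<exists>fs. length fs = d \<and> (\<forall>f\<in>set fs. affine_fun f) \<and>
    (\<forall>x :: real ^ 'n. (\<Prod>i\<in>UNIV. x $ i ^ e i) = (\<Prod>f\<leftarrow>fs. f x))"
  using assms
proof (induction d arbitrary: e)
  case 0
  then show ?case by simp
next
  case (Suc d)
  show ?case
  proof (cases "sum e UNIV \<le> d")
    case True
    from Suc.IH[OF this] obtain fs where "length fs = d" "\<forall>f\<in>set fs. affine_fun f"
      "\<forall>x :: real ^ 'n. (\<Prod>i\<in>UNIV. x $ i ^ e i) = (\<Prod>f\<leftarrow>fs. f x)" by blast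
    then show ?thesis by (intro exI[of _ "(\<lambda>_. 1) # fs"]) (simp add: affine_fun_const)
  next
    case False
    have "\<exists>j. e j > 0"
      by (rule ccontr) (use False in simp)
    then obtain j where j: "e j > 0" ..
    define e' where "e' = e(j := e j - 1)"
    have e: "e i = e' i + of_bool (i = j)" for i using j by (simp add: e'_def)
    have "sum e UNIV = Suc (sum e' UNIV)" by (simp add: e sum.distrib of_bool_def)
    with Suc.prems have "sum e' UNIV \<le> d" by simp
    from Suc.IH[OF this] obtain fs where fs: "length fs = d" "\<forall>f\<in>set fs. affine_fun f"
      "\<forall>x :: real ^ 'n. (\<Prod>i\<in>UNIV. x $ i ^ e' i) = (\<Prod>f\<leftarrow>fs. f x)" by blast
    have "(\<Prod>i\<in>UNIV. x $ i ^ e i) = x $ j * (\<Prod>i\<in>UNIV. x $ i ^ e' i)" for x :: "real ^ 'n"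
      unfolding e by (rule monomial_coordinate_mult)
    with fs show ?thesis
      by (intro exI[of _ "(\<lambda>x. x $ j) # fs"]) (simp add: affine_fun_coordinate)
  qed
qed

text \<open>The form of induction that the quadrature rule uses: integrals of products of affine functions depend only on
vertex values, whereas monomials in the coordinates have no such description.\<close>

lemma polys_upto_3_induct [consumes 1, case_names affine3 add scale]:
  assumes "U \<in> polys_upto 3"
    and affine3: "\<And>f g h. affine_fun f \<Longrightarrow> affine_fun g \<Longrightarrow> affine_fun h \<Longrightarrow> P (\<lambda>x. f x * g x * h x)"
    and add: "\<And>U U'. U \<in> polys_upto 3 \<Longrightarrow> U' \<in> polys_upto 3 \<Longrightarrow> P U \<Longrightarrow> P U' \<Longrightarrow> P (\<lambda>x. U x + U' x)"
    and scale: "\<And>r U. P U \<Longrightarrow> P (\<lambda>x. r * U x)"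
  shows "P U"
proof -
  have "U \<in> polys_upto 3 \<and> P U"
    using assms(1)
  proof (induction rule: polys_upto_induct)
    case (monomial e)
    from monomial_affine_factors[OF this] obtain fs where fs: "length fs = 3" "\<forall>f\<in>set fs. affine_fun f"
      "\<And>x. (\<Prod>i\<in>UNIV. x $ i ^ e i) = (\<Prod>f\<leftarrow>fs. f x)" by blast
    from fs(1) obtain f g h where "fs = [f, g, h]"
      by (auto simp: numeral_3_eq_3 length_Suc_conv)
    with fs(2) affine3[of f g h] have "P (\<lambda>x. \<Prod>i\<in>UNIV. x $ i ^ e i)"
      by (simp add: fs(3) mult.assoc)
    then show ?case using monomial by (simp add: polys_upto_monomial)
  qed (auto intro: polys_upto_add polys_upto_scale add scale)
  then show ?thesis ..
qed

text \<open>Differences of the vertices from a fixed vertex are linearly independent, so a linear function may take any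
prescribed values on them.\<close>

lemma affine_interpolation:
  fixes V :: "'a :: euclidean_space set" and \<phi> :: "'a \<Rightarrow> real"
  assumes "\<not> affine_dependent V"
  obtains f where "affine_fun f" "\<And>v. v \<in> V \<Longrightarrow> f v = \<phi> v"
proof (cases "V = {}")
  case True
  then show ?thesis using that[OF affine_fun_const] by simp
next
  case False
  then obtain a where a: "a \<in> V" by blast
  then have "independent ((\<lambda>x. - a + x) ` (V - {a}))"
    using assms affine_dependent_iff_dependent2 by blast
  from linear_independent_extend[OF this, of "\<lambda>x. \<phi> (a + x) - \<phi> a"]
  obtain g where g: "linear g" "\<forall>v\<in>V - {a}. g (- a + v) = \<phi> v - \<phi> a" by auto
  show ?thesis
  proof (rule that)
    show "affine_fun (\<lambda>x. (\<phi> a - g a) + g x)" using g(1) by (auto simp: affine_fun_def)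
    show "(\<phi> a - g a) + g v = \<phi> v" if "v \<in> V" for v
    proof (cases "v = a")
      case False
      then have "g v - g a = \<phi> v - \<phi> a"
        using that g by (metis Diff_iff add.commute linear_diff singletonD uminus_add_conv_diff)
      then show ?thesis by simp
    qed simp
  qed
qed

section \<open>The quadrature rule at the centroids\<close>

lemma affine_fun_centroid:
  assumes "affine_fun f" "finite W" "W \<noteq> {}"
  shows "f (centroid W) = sum f W / card W"
proof -
  have "(\<Sum>v\<in>W. 1 / real (card W)) = 1" using assms by simp
  from affine_fun_combination[OF assms(1) this] show ?thesis
    by (simp add: centroid_def scaleR_right.sum sum_divide_distrib)
qed

lemma centroid_in_hull:
  assumes "finite W" "W \<noteq> {}"
  shows "centroid W \<in> convex hull W"
  unfolding centroid_def scaleR_right.sum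
  using assms by (intro convex_sum convex_convex_hull) (auto simp: hull_inc)

text \<open>The sums over the face opposite to \<open>v\<close> are the full sums minus the values at \<open>v\<close>. Expanding and summing over
\<open>v\<close> turns data of the faces into data of the cell. The same computation serves the centroids of the
faces and, with the next two lemmas, the boundary average.\<close>

lemma sum_complement_product:
  fixes f g h :: "'a \<Rightarrow> real"
  assumes "finite V"
  shows "(\<Sum>v\<in>V. sum f (V - {v}) * sum g (V - {v}) * sum h (V - {v})) =
    (real (card V) - 3) * (sum f V * sum g V * sum h V)
      + (sum f V * (\<Sum>v\<in>V. g v * h v) + sum g V * (\<Sum>v\<in>V. f v * h v) + sum h V * (\<Sum>v\<in>V. f v * g v))
      - (\<Sum>v\<in>V. f v * g v * h v)"
proof -
  have "(\<Sum>v\<in>V. (F - f v) * (G - g v) * (H - h v)) =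
    real (card V) * (F * G * H) - F * G * sum h V - F * H * sum g V - G * H * sum f V
      + (F * (\<Sum>v\<in>V. g v * h v) + G * (\<Sum>v\<in>V. f v * h v) + H * (\<Sum>v\<in>V. f v * g v))
      - (\<Sum>v\<in>V. f v * g v * h v)" for F G H :: real
    \<comment> \<open>The full sums are generalized to constants, which keeps the distributive laws from expanding products of sums.\<close>
    by (simp add: algebra_simps sum.distrib sum_subtractf sum_distrib_left)
  from this[of "sum f V" "sum g V" "sum h V"] show ?thesis
    using assms by (simp add: sum_diff1 algebra_simps)
qed

lemma sum_complement_product2:
  fixes f q :: "'a \<Rightarrow> real"
  assumes "finite V"
  shows "(\<Sum>v\<in>V. sum f (V - {v}) * sum q (V - {v})) =
    (real (card V) - 2) * (sum f V * sum q V) + (\<Sum>v\<in>V. f v * q v)"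
proof -
  have "(\<Sum>v\<in>V. (F - f v) * (Q - q v)) =
      real (card V) * (F * Q) - F * sum q V - Q * sum f V + (\<Sum>v\<in>V. f v * q v)" for F Q :: real
    by (simp add: algebra_simps sum.distrib sum_subtractf sum_distrib_left)
  from this[of "sum f V" "sum q V"] show ?thesis
    using assms by (simp add: sum_diff1 algebra_simps)
qed

lemma sum_complement:
  fixes q :: "'a \<Rightarrow> real"
  assumes "finite V"
  shows "(\<Sum>v\<in>V. sum q (V - {v})) = (real (card V) - 1) * sum q V"
  using assms by (simp add: sum_diff1 sum_subtractf algebra_simps)

lemma face_nonempty:
  assumes "card V \<ge> 2"
  shows "V - {v} \<noteq> {}"
  using assms card_mono[of "{v}" V] by (auto simp: subset_singleton_iff)

text \<open>A face has \<open>k - 1\<close> vertices, so \<open>simplex_avg_affine3\<close> on a face has the denominator \<open>(k - 1) k (k + 1)\<close>.\<close>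

lemma boundary_avg_affine3:
  fixes V :: "(real ^ 'n) set"
  assumes V: "card V \<ge> 2" and aff: "affine_fun f" "affine_fun g" "affine_fun h"
  defines "k \<equiv> real (card V)"
  shows "boundary_avg V (\<lambda>x. f x * g x * h x) =
    ((k - 3) * (sum f V * sum g V * sum h V)
      + (k - 1) * (sum f V * (\<Sum>v\<in>V. g v * h v) + sum g V * (\<Sum>v\<in>V. f v * h v) + sum h V * (\<Sum>v\<in>V. f v * g v))
      + 2 * k * (\<Sum>v\<in>V. f v * g v * h v)) / (k * ((k - 1) * k * (k + 1)))"
proof -
  have fin: "finite V" using V by (auto intro: card_ge_0_finite)
  have face: "simplex_avg (V - {v}) (\<lambda>x. f x * g x * h x) =
      (sum f (V - {v}) * sum g (V - {v}) * sum h (V - {v})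
        + sum f (V - {v}) * (\<Sum>v\<in>V - {v}. g v * h v)
        + sum g (V - {v}) * (\<Sum>v\<in>V - {v}. f v * h v)
        + sum h (V - {v}) * (\<Sum>v\<in>V - {v}. f v * g v)
        + 2 * (\<Sum>v\<in>V - {v}. f v * g v * h v)) / ((k - 1) * k * (k + 1))" if "v \<in> V" for v
  proof -
    have "card (V - {v}) = card V - 1" using that fin by simp
    then show ?thesis
      using face_nonempty[OF V, of v] simplex_avg_affine3[OF _ _ aff, of "V - {v}"] fin V by (simp add: k_def)
  qed
  show ?thesis
    unfolding boundary_avg_def k_def[symmetric]
    by (simp add: face sum_divide_distrib[symmetric] sum.distrib sum_distrib_left[symmetric]
        sum_complement_product sum_complement_product2 sum_complement fin del: sum_diff1)
       (simp add: k_def[symmetric] algebra_simps)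
qed

text \<open>The solution of the three equations that compare the coefficients of \<open>A\<close>, \<open>B\<close> and \<open>C\<close>. The equations for \<open>B\<close>
and \<open>C\<close> involve only the face and boundary weights; their sum no longer contains the face weight and has a multiple
of \<open>3 k - 1\<close> as the coefficient of the boundary weight. The factor \<open>14 - 2 k\<close> limits the method to \<open>k \<le> 7\<close>.\<close>

definition centroid_weight :: "real \<Rightarrow> real" where
  "centroid_weight k = k\<^sup>2 * (14 - 2 * k) / ((k + 1) * (k + 2) * (3 * k - 1))"

definition face_weight :: "real \<Rightarrow> real" where
  "face_weight k = 2 * (k - 1) ^ 3 / (k * (k + 1) * (k + 2) * (3 * k - 1))"

definition boundary_weight :: "real \<Rightarrow> real" where
  "boundary_weight k = 3 * k * (k - 1) / ((3 * k - 1) * (k + 2))"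

lemma quadrature_weights:
  fixes k :: real
  assumes "k > 1"
  shows "((A + B + 2 * C) / (k * (k + 1) * (k + 2))) =
     centroid_weight k * (A / k ^ 3) + face_weight k * (((k - 3) * A + B - C) / (k - 1) ^ 3)
      + boundary_weight k * (((k - 3) * A + (k - 1) * B + 2 * k * C) / (k * ((k - 1) * k * (k + 1))))"
proof -
  have "3 * k - 1 \<noteq> 0" "k \<noteq> 0" "k + 1 \<noteq> 0" "k + 2 \<noteq> 0" "k - 1 \<noteq> 0" using assms by auto
  then show ?thesis
    unfolding centroid_weight_def face_weight_def boundary_weight_def
    by (simp add: divide_simps) algebra
qed

text \<open>Exactness on products of three affine functions is the algebraic identity \<open>quadrature_weights\<close>, and both sides are
linear in \<open>U\<close>.\<close>

lemma quadrature_identity: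
  fixes V :: "(real ^ 'n) set"
  assumes V: "card V \<ge> 2" and U: "U \<in> polys_upto 3"
  defines "k \<equiv> real (card V)"
  shows "simplex_avg V U = centroid_weight k * U (centroid V)
    + face_weight k * (\<Sum>v\<in>V. U (centroid (V - {v}))) + boundary_weight k * boundary_avg V U"
  using U
proof (induction rule: polys_upto_3_induct)
  case (affine3 f g h)
  have fin: "finite V" "V \<noteq> {}" using V by (auto intro: card_ge_0_finite)
  note ne = face_nonempty[OF V]
  have face: "q (centroid (V - {v})) = sum q (V - {v}) / (k - 1)" if "v \<in> V" "affine_fun q" for q v
    using affine_fun_centroid[OF that(2) _ ne] fin V that(1) by (simp add: k_def)
  let ?A = "sum f V * sum g V * sum h V"
  let ?B = "sum f V * (\<Sum>v\<in>V. g v * h v) + sum g V * (\<Sum>v\<in>V. f v * h v) + sum h V * (\<Sum>v\<in>V. f v * g v)"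
  let ?C = "\<Sum>v\<in>V. f v * g v * h v"
  have "simplex_avg V (\<lambda>x. f x * g x * h x) = (?A + ?B + 2 * ?C) / (k * (k + 1) * (k + 2))"
    using simplex_avg_affine3[OF fin affine3] by (simp add: k_def add.assoc)
  moreover have "f (centroid V) * g (centroid V) * h (centroid V) = ?A / k ^ 3"
    using affine3 fin by (simp add: affine_fun_centroid k_def power3_eq_cube)
  moreover have "(\<Sum>v\<in>V. f (centroid (V - {v})) * g (centroid (V - {v})) * h (centroid (V - {v}))) =
      ((k - 3) * ?A + ?B - ?C) / (k - 1) ^ 3"
  proof -
    have "(\<Sum>v\<in>V. f (centroid (V - {v})) * g (centroid (V - {v})) * h (centroid (V - {v}))) =
        (\<Sum>v\<in>V. sum f (V - {v}) * sum g (V - {v}) * sum h (V - {v}) / (k - 1) ^ 3)"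
      using affine3 by (intro sum.cong) (simp_all only: face times_divide_times_eq power3_eq_cube)
    then show ?thesis
      using sum_complement_product[OF fin(1), of f g h] by (simp only: sum_divide_distrib[symmetric] k_def)
  qed
  moreover have "boundary_avg V (\<lambda>x. f x * g x * h x) =
      ((k - 3) * ?A + (k - 1) * ?B + 2 * k * ?C) / (k * ((k - 1) * k * (k + 1)))"
    unfolding k_def by (rule boundary_avg_affine3[OF V affine3])
  moreover have "k > 1" using V by (simp add: k_def)
  ultimately show ?case
    using quadrature_weights[of k ?A ?B ?C] by (simp only:)
next
  case (add U U')
  have fin: "finite V" "V \<noteq> {}" using V by (auto intro: card_ge_0_finite)
  note ne = face_nonempty[OF V]
  have avg: "simplex_avg W (\<lambda>x. U x + U' x) = simplex_avg W U + simplex_avg W U'" if "finite W" "W \<noteq> {}" for W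
    using that add.hyps by (intro simplex_avg_add polys_upto_continuous)
  have "boundary_avg V (\<lambda>x. U x + U' x) = boundary_avg V U + boundary_avg V U'"
    using fin ne by (simp add: boundary_avg_def avg sum.distrib add_divide_distrib)
  then show ?case
    using add.IH by (simp only: avg[OF fin] sum.distrib) (simp add: algebra_simps)
next
  case (scale r U)
  have fin: "finite V" "V \<noteq> {}" using V by (auto intro: card_ge_0_finite)
  note ne = face_nonempty[OF V]
  have "boundary_avg V (\<lambda>x. r * U x) = r * boundary_avg V U"
    using fin ne by (simp add: boundary_avg_def simplex_avg_mult sum_distrib_left)
  then show ?case
    using scale.IH fin by (simp add: simplex_avg_mult sum_distrib_left[symmetric] algebra_simps)
qed

section \<open>Optimality and the extremal polynomial\<close>

lemma barycentric_coordinates: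
  fixes V :: "'a :: euclidean_space set"
  assumes "\<not> affine_dependent V"
  obtains b where "\<And>u. affine_fun (b u)" "\<And>u v. v \<in> V \<Longrightarrow> b u v = of_bool (u = v)"
proof -
  have "\<exists>f. affine_fun f \<and> (\<forall>v\<in>V. f v = of_bool (u = v))" for u
    using affine_interpolation[OF assms, of "\<lambda>v. of_bool (u = v)"] by metis
  then show ?thesis using that by metis
qed

lemma barycentric_centroid:
  fixes W :: "(real ^ 'n) set"
  assumes b: "affine_fun (b u)" "\<And>v. v \<in> W \<Longrightarrow> b u v = of_bool (u = v)" and W: "finite W" "W \<noteq> {}"
  shows "b u (centroid W) = of_bool (u \<in> W) / card W"
proof -
  have "sum (b u) W = (\<Sum>v\<in>W. if u = v then 1 else 0)"
    using b(2) by (intro sum.cong) auto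
  then show ?thesis using W by (simp add: affine_fun_centroid[OF b(1)])
qed

lemma barycentric_nonneg:
  fixes V :: "'a :: euclidean_space set"
  assumes "finite V" "affine_fun b" "\<And>v. v \<in> V \<Longrightarrow> 0 \<le> b v" "x \<in> convex hull V"
  shows "0 \<le> b x"
proof -
  obtain l where l: "\<forall>v\<in>V. 0 \<le> l v" "sum l V = 1" "(\<Sum>v\<in>V. l v *\<^sub>R v) = x"
    using assms(4) unfolding convex_hull_finite[OF assms(1)] by auto
  then show ?thesis
    using affine_fun_combination[OF assms(2) l(2)] assms(3) by (auto intro: sum_nonneg)
qed

definition schur :: "real \<Rightarrow> real \<Rightarrow> real \<Rightarrow> real" where
  "schur x y z = x * (x - y) * (x - z) + y * (y - z) * (y - x) + z * (z - x) * (z - y)"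

text \<open>By symmetry the arguments may be sorted; the value is then a sum of products of nonnegative factors.\<close>

lemma schur_nonneg:
  assumes "0 \<le> x" "0 \<le> y" "0 \<le> z"
  shows "0 \<le> schur x y z"
proof -
  have sorted: "0 \<le> schur x y z" if "z \<le> y" "y \<le> x" "0 \<le> z" for x y z
  proof -
    have "schur x y z = (x - y) * (x - y) * (x + y - z) + z * ((x - z) * (y - z))"
      by (simp add: schur_def algebra_simps)
    then show ?thesis using that by simp
  qed
  have "schur x y z = schur y x z" "schur x y z = schur x z y" "schur x y z = schur y z x"
    "schur x y z = schur z x y" "schur x y z = schur z y x"
    by (simp_all add: schur_def algebra_simps)
  then show ?thesis using sorted assms by (metis linear)
qed

text \<open>Weak duality with complementary slackness: the point evaluations in the rule are nonnegative on the admissible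
functions, which bounds the ratio, and they all vanish on \<open>U\<^sub>0\<close>, which attains the bound.\<close>

lemma optimal_interior_weight_eqI:
  assumes rule: "quadrature_rule P V X w W" and W: "W > 0" and X: "X \<subseteq> convex hull V"
    and U\<^sub>0: "U\<^sub>0 \<in> P" "\<And>x. x \<in> convex hull V \<Longrightarrow> 0 \<le> U\<^sub>0 x" "\<And>x. x \<in> X \<Longrightarrow> U\<^sub>0 x = 0" "0 < cell_avg V U\<^sub>0"
  shows "optimal_interior_weight P V = ereal (1 / W)"
proof (rule antisym)
  show "optimal_interior_weight P V \<le> ereal (1 / W)"
    unfolding optimal_interior_weight_def
  proof (rule Sup_least, clarify)
    fix U assume U: "U \<in> P" "\<forall>x\<in>convex hull V. 0 \<le> U x" "0 < cell_avg V U"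
    have "0 \<le> (\<Sum>x\<in>X. w x * U x)"
      using rule X U(2) by (intro sum_nonneg mult_nonneg_nonneg) (auto simp: quadrature_rule_def)
    then have "W * boundary_avg V U \<le> cell_avg V U"
      using rule U(1) by (simp add: quadrature_rule_def)
    then show "ereal (boundary_avg V U / cell_avg V U) \<le> ereal (1 / W)"
      using U(3) W by (simp add: field_simps)
  qed
  have "cell_avg V U\<^sub>0 = W * boundary_avg V U\<^sub>0"
    using rule U\<^sub>0 by (simp add: quadrature_rule_def)
  then have "boundary_avg V U\<^sub>0 / cell_avg V U\<^sub>0 = 1 / W"
    using U\<^sub>0(4) W by (auto simp: field_simps)
  then show "ereal (1 / W) \<le> optimal_interior_weight P V"
    unfolding optimal_interior_weight_def using U\<^sub>0 by (intro Sup_upper CollectI exI[of _ U\<^sub>0]) auto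
qed

text \<open>The rule combines the weights above with the fact that its points are pairwise distinct, as barycentric coordinates
tell them apart; equality comes from a Schur polynomial. Dimension at least \<open>2\<close> provides the three vertices that Schur's
polynomial needs, and dimension at most \<open>6\<close> makes the centroid weight nonnegative.\<close>

lemma cubic_optimal_weight:
  fixes V :: "(real ^ 'n :: {finite, wellorder}) set"
  assumes V: "simplex_vertices V" and dim: "2 \<le> CARD('n)" "CARD('n) \<le> 6"
  defines "k \<equiv> real CARD('n) + 1"
  shows "\<exists>w. quadrature_rule (polys_upto 3) V (insert (centroid V) ((\<lambda>v. centroid (V - {v})) ` V)) w (boundary_weight k)"
    and "optimal_interior_weight (polys_upto 3) V = ereal (1 / boundary_weight k)"
proof -
  have card: "card V = CARD('n) + 1" and indep: "\<not> affine_dependent V"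
    using V by (auto simp: simplex_vertices_def)
  have k: "k = real (card V)" "3 \<le> k" "k \<le> 7" using card dim by (auto simp: k_def)
  have fin: "finite V" "V \<noteq> {}" using card by (auto intro: card_ge_0_finite)
  have ne: "V - {v} \<noteq> {}" for v
    using card dim by (intro face_nonempty) simp
  obtain b where b: "\<And>u. affine_fun (b u)" "\<And>u v. v \<in> V \<Longrightarrow> b u v = of_bool (u = v)"
    using barycentric_coordinates[OF indep] by metis
  have bc: "b u (centroid V) = 1 / k" if "u \<in> V" for u
    using barycentric_centroid[of b u V] b fin that by (simp add: k)
  have bf: "b u (centroid (V - {v})) = of_bool (u \<noteq> v) / (k - 1)" if "u \<in> V" "v \<in> V" for u v
    using barycentric_centroid[of b u "V - {v}"] b fin that ne card by (simp add: k)
  define X where "X = insert (centroid V) ((\<lambda>v. centroid (V - {v})) ` V)"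
  define w where "w = (\<lambda>x. if x = centroid V then centroid_weight k else face_weight k)"
  have notin: "centroid V \<noteq> centroid (V - {v})" if "v \<in> V" for v
    using bc[OF that] bf[OF that that] k by auto
  have inj: "inj_on (\<lambda>v. centroid (V - {v})) V"
  proof (rule inj_onI, rule ccontr)
    fix u v assume uv: "u \<in> V" "v \<in> V" "centroid (V - {u}) = centroid (V - {v})" "u \<noteq> v"
    then show False using bf[of u u] bf[of u v] k by simp
  qed
  have rule: "quadrature_rule (polys_upto 3) V X w (boundary_weight k)"
    unfolding quadrature_rule_def
  proof (intro conjI ballI)
    show "finite X" using fin by (simp add: X_def)
    show "0 \<le> w x" for x
      using k by (auto simp: w_def centroid_weight_def face_weight_def)
    fix U :: "real ^ 'n::_ \<Rightarrow> real" assume U: "U \<in> polys_upto 3"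
    have "(\<Sum>x\<in>X. w x * U x) = centroid_weight k * U (centroid V) + (\<Sum>v\<in>V. w (centroid (V - {v})) * U (centroid (V - {v})))"
      unfolding X_def using notin inj fin by (subst sum.insert) (auto simp: sum.reindex w_def)
    also have "(\<Sum>v\<in>V. w (centroid (V - {v})) * U (centroid (V - {v}))) = face_weight k * (\<Sum>v\<in>V. U (centroid (V - {v})))"
      unfolding sum_distrib_left by (intro sum.cong) (auto simp: w_def notin[symmetric])
    finally show "cell_avg V U = (\<Sum>x\<in>X. w x * U x) + boundary_weight k * boundary_avg V U"
      using quadrature_identity[OF _ U, of V] card dim cell_avg_eq_simplex_avg[OF V polys_upto_continuous[OF U]]
      by (simp add: k)
  qed
  then show "\<exists>w. quadrature_rule (polys_upto 3) V (insert (centroid V) ((\<lambda>v. centroid (V - {v})) ` V)) w (boundary_weight k)"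
    unfolding X_def by blast
  have "3 \<le> card V" using card dim by simp
  then obtain T where "T \<subseteq> V" "card T = 3" using obtain_subset_with_card_n by metis
  then obtain p q r where pqr: "p \<in> V" "q \<in> V" "r \<in> V" "p \<noteq> q" "q \<noteq> r" "p \<noteq> r"
    by (auto simp: card_3_iff)
  define U\<^sub>0 where "U\<^sub>0 = (\<lambda>x. schur (b p x) (b q x) (b r x))"
  \<comment> \<open>Each of the three summands of Schur's polynomial is a product of affine functions and has the average
      \<open>3 / (k (k + 1) (k + 2))\<close>: the differences of coordinates have vertex sum \<open>0\<close>, which leaves two of the five terms of
      \<open>simplex_avg_affine3\<close>. So \<open>U\<^sub>0\<close> has a positive average.\<close>
  have schur_term: "(\<lambda>x. b u x * (b u x - b v x) * (b u x - b w x)) \<in> polys_upto 3"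
     "simplex_avg V (\<lambda>x. b u x * (b u x - b v x) * (b u x - b w x)) = 3 / (k * (k + 1) * (k + 2))"
     if uvw: "u \<in> V" "v \<in> V" "w \<in> V" "u \<noteq> v" "u \<noteq> w" "v \<noteq> w" for u v w
  proof -
    have aff: "affine_fun (b u)" "affine_fun (\<lambda>x. b u x - b v x)" "affine_fun (\<lambda>x. b u x - b w x)"
      by (intro b(1) affine_fun_diff)+
    show "(\<lambda>x. b u x * (b u x - b v x) * (b u x - b w x)) \<in> polys_upto 3"
      by (rule affine3_in_polys_upto[OF aff])
    have s: "sum (b z) V = 1" if "z \<in> V" for z
      using that fin by (simp add: b(2) of_bool_def)
    have p: "(\<Sum>x\<in>V. b z x * q x) = q z" if "z \<in> V" for z q
      using that fin by (simp add: b(2) of_bool_def if_distrib[of "\<lambda>x. x * _"] cong: if_cong)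
    have p': "(\<Sum>x\<in>V. (b u x - b v x) * (b u x - b w x)) = 1"
      using uvw by (simp only: left_diff_distrib sum_subtractf p) (simp add: b(2))
    show "simplex_avg V (\<lambda>x. b u x * (b u x - b v x) * (b u x - b w x)) = 3 / (k * (k + 1) * (k + 2))"
      unfolding simplex_avg_affine3[OF fin aff] k(1)
      using uvw by (simp only: sum_subtractf s p p' mult.assoc) (simp add: b(2))
  qed
  note terms = schur_term[of p q r] schur_term[of q r p] schur_term[of r p q]
  have U\<^sub>0: "U\<^sub>0 \<in> polys_upto 3"
    unfolding U\<^sub>0_def schur_def using pqr by (intro polys_upto_add terms) auto
  show "optimal_interior_weight (polys_upto 3) V = ereal (1 / boundary_weight k)"
  proof (rule optimal_interior_weight_eqI[OF rule _ _ U\<^sub>0])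
    show "0 < boundary_weight k" using k by (simp add: boundary_weight_def)
    have "centroid (V - {v}) \<in> convex hull V" for v
      using centroid_in_hull[OF _ ne, of v] fin hull_mono[of "V - {v}" V] by blast
    then show "X \<subseteq> convex hull V" using centroid_in_hull[OF fin] by (auto simp: X_def)
    show "0 \<le> U\<^sub>0 x" if "x \<in> convex hull V" for x
    proof -
      have "0 \<le> b u x" for u
        by (rule barycentric_nonneg[OF fin(1) b(1) _ that]) (simp add: b(2))
      then show ?thesis unfolding U\<^sub>0_def by (intro schur_nonneg)
    qed
    show "U\<^sub>0 x = 0" if "x \<in> X" for x
      using that pqr by (auto simp: X_def U\<^sub>0_def bc bf schur_def)
    have "cell_avg V U\<^sub>0 = simplex_avg V U\<^sub>0"
      by (rule cell_avg_eq_simplex_avg[OF V polys_upto_continuous[OF U\<^sub>0]])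
    also have "\<dots> = 9 / (k * (k + 1) * (k + 2))"
    proof -
      have cont: "continuous_on UNIV (\<lambda>x. b u x * (b u x - b v x) * (b u x - b w x))" for u v w
        by (intro continuous_intros affine_fun_continuous b(1))
      show ?thesis
        unfolding U\<^sub>0_def schur_def using pqr
        by (simp add: simplex_avg_add[OF fin] cont continuous_on_add terms)
    qed
    also have "\<dots> > 0" using k by simp
    finally show "0 < cell_avg V U\<^sub>0" .
  qed
qed

lemma face_centroids_triangle:
  assumes "card V = 3"
  shows "(\<lambda>v. centroid (V - {v})) ` V = edge_midpoints V"
proof -
  obtain a b c where V: "V = {a, b, c}" "a \<noteq> b" "b \<noteq> c" "a \<noteq> c"
    using assms by (auto simp: card_3_iff)
  have m: "centroid {x, y} = midpoint x y" if "x \<noteq> y" for x y :: "real ^ 'n"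
    using that by (simp add: centroid_def midpoint_def)
  have "(\<lambda>v. centroid (V - {v})) ` V = {midpoint b c, midpoint a c, midpoint a b}"
    using V by (simp add: insert_Diff_if m)
  also have "\<dots> = edge_midpoints V"
    unfolding edge_midpoints_def V(1) using V(2-4) by (auto simp: midpoint_sym)
  finally show ?thesis .
qed

theorem theorem6p9:
  "(\<forall>V :: (real ^ 2) set. simplex_vertices V \<longrightarrow>
      optimal_interior_weight (polys_upto 3) V = ereal (20 / 9) \<and>
      optimal_retentional_points (polys_upto 3) V (insert (centroid V) (edge_midpoints V)) \<and>
      (\<exists>w. quadrature_rule (polys_upto 3) V (insert (centroid V) (edge_midpoints V)) w (9 / 20)))
   \<and> (\<forall>V :: (real ^ 3) set. simplex_vertices V \<longrightarrow>
      optimal_interior_weight (polys_upto 3) V = ereal (11 / 6))"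
proof (intro conjI allI impI)
  fix V :: "(real ^ 2) set"
  assume V: "simplex_vertices V"
  have weight: "boundary_weight 3 = 9 / 20" by (simp add: boundary_weight_def)
  from V have "card V = 3" by (simp add: simplex_vertices_def)
  then show rule: "\<exists>w. quadrature_rule (polys_upto 3) V (insert (centroid V) (edge_midpoints V)) w (9 / 20)"
    and opt: "optimal_interior_weight (polys_upto 3) V = ereal (20 / 9)"
    using cubic_optimal_weight[OF V] by (simp_all add: face_centroids_triangle weight)
  have "ereal (9 / 20) = 1 / optimal_interior_weight (polys_upto 3) V" by (simp add: opt one_ereal_def)
  then show "optimal_retentional_points (polys_upto 3) V (insert (centroid V) (edge_midpoints V))"
    unfolding optimal_retentional_points_def using rule by blast
next
  fix V :: "(real ^ 3) set"
  assume "simplex_vertices V"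
  from cubic_optimal_weight(2)[OF this] show "optimal_interior_weight (polys_upto 3) V = ereal (11 / 6)"
    by (simp add: boundary_weight_def)
qed

end
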